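(* For every positive integer $n$, the group $PL(I^n)$ embeds in the group $PL(S^n)$; that is, there exists an injective group homomorphism $PL(I^n)\to PL(S^n)$.
   Context: For each positive integer $n$, let $I^n_p$ and $S^n_p$ be polyhedra in $\mathbf{R}^n$ and $\mathbf{R}^{n+1}$ which are homeomorphic to the $n$-cube $I^n=[0,1]^n$ and the $n$-sphere $S^n$ respectively, where $\mathbf{R}^{n+1}$ is further required to admit a (hyper)plane of reflective symmetry for $S^n_p$, so that $S^n_p$ is realized as the union of two piecewise-linear homeomorphic images of $I^n_p$, identified together on their common boundary, where one image is the reflection of the other across the plane of symmetry, and their common boundary lies in the plane of symmetry. (So the $n$-sphere is constructed as a doubled $n$-cube.) $\mathrm{Homeo}(I^n)$ and $\mathrm{Homeo}(S^n)$ are the full groups of self-homeomorphisms of $I^n_p$ and $S^n_p$ under composition, and $PL(I^n)$ and $PL(S^n)$ are their respective subgroups consisting of the piecewise-linear self-homeomorphisms. *)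

theory Defs
  imports "HOL-Analysis.Analysis" "HOL-Algebra.Bij"
begin

text \<open>
  Polyhedra in the sense of piecewise-linear topology, not necessarily convex (unlike the
  library's \<^const>\<open>polyhedron\<close>). A compact polyhedron is the underlying space of a finite
  simplicial complex; only compact ones occur below, as cubes and spheres are compact.
\<close>

definition pl_polyhedron :: "'a::euclidean_space set \<Rightarrow> bool" where
  "pl_polyhedron P \<longleftrightarrow> (\<exists>\<K>. simplicial_complex \<K> \<and> \<Union>\<K> = P)"

definition affine_map_on :: "'a::euclidean_space set \<Rightarrow> ('a \<Rightarrow> 'b::euclidean_space) \<Rightarrow> bool" where
  "affine_map_on K f \<longleftrightarrow> (\<exists>L c. linear L \<and> (\<forall>x\<in>K. f x = L x + c))"

definition piecewise_linear_on ::
    "'a::euclidean_space set \<Rightarrow> ('a \<Rightarrow> 'b::euclidean_space) \<Rightarrow> bool" where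
  "piecewise_linear_on P f \<longleftrightarrow>
     (\<exists>\<K>. simplicial_complex \<K> \<and> \<Union>\<K> = P \<and> (\<forall>K\<in>\<K>. affine_map_on K f))"

definition pl_homeomorphism ::
    "'a::euclidean_space set \<Rightarrow> 'b::euclidean_space set \<Rightarrow> ('a \<Rightarrow> 'b) \<Rightarrow> bool" where
  "pl_homeomorphism P Q f \<longleftrightarrow> (\<exists>g. homeomorphism P Q f g) \<and> piecewise_linear_on P f"

text \<open>
  As in \<^const>\<open>BijGroup\<close>, a self-map of \<open>P\<close> is represented by its extensional representative
  (equal to \<^const>\<open>undefined\<close> outside \<open>P\<close>); the operation is composition on \<open>P\<close>.
\<close>

definition Homeo_group :: "'a::euclidean_space set \<Rightarrow> ('a \<Rightarrow> 'a) monoid" where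
  "Homeo_group P = (BijGroup P)\<lparr>carrier := {f \<in> Bij P. \<exists>g. homeomorphism P P f g}\<rparr>"

definition PL_group :: "'a::euclidean_space set \<Rightarrow> ('a \<Rightarrow> 'a) monoid" where
  "PL_group P =
     (Homeo_group P)\<lparr>carrier := {f \<in> carrier (Homeo_group P). pl_homeomorphism P P f}\<rparr>"

text \<open>Orthogonal reflection across the hyperplane \<open>{x. a \<bullet> x = b}\<close>, for \<open>a \<noteq> 0\<close>.\<close>

definition reflect_across :: "'a::euclidean_space \<Rightarrow> real \<Rightarrow> 'a \<Rightarrow> 'a" where
  "reflect_across a b x = x - (2 * (a \<bullet> x - b) / (a \<bullet> a)) *\<^sub>R a"

text \<open>
  \<open>S\<close> is the double of \<open>I\<close> across the hyperplane \<open>{x. a \<bullet> x = b}\<close>. As \<open>I\<close> will be an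
  \<open>n\<close>-cell lying in \<open>n\<close>-dimensional space, its boundary as a manifold is its topological
  frontier (invariance of domain), and the boundary of a homeomorphic image of \<open>I\<close> is the
  image of that frontier.
\<close>

definition doubled_across ::
    "'b::euclidean_space \<Rightarrow> real \<Rightarrow> 'a::euclidean_space set \<Rightarrow> 'b set \<Rightarrow> bool" where
  "doubled_across a b I S \<longleftrightarrow>
     a \<noteq> 0 \<and> reflect_across a b ` S = S \<and>
     (\<exists>A B \<phi> \<psi>. pl_homeomorphism I A \<phi> \<and> pl_homeomorphism I B \<psi> \<and>
        S = A \<union> B \<and> B = reflect_across a b ` A \<and>
        A \<inter> B = \<phi> ` frontier I \<and> A \<inter> B = \<psi> ` frontier I \<and>
        A \<inter> B \<subseteq> {x. a \<bullet> x = b})"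

end

theory Submission
  imports Defs
begin

text \<open>
  Let \<open>S = A \<union> r ` A\<close>, where \<open>\<phi>\<close> is a piecewise linear homeomorphism from \<open>I\<close> onto \<open>A\<close> and \<open>r\<close> is
  the reflection. A self-map \<open>f\<close> of \<open>I\<close> is transported to \<open>\<phi> \<circ> f \<circ> \<phi>\<^sup>-\<^sup>1\<close> on \<open>A\<close> and to the mirror
  image of this map on \<open>r ` A\<close>. The two halves agree where they meet: the seam \<open>A \<inter> r ` A\<close> is
  fixed pointwise by \<open>r\<close>, and it is mapped to itself because \<open>f\<close> maps the frontier of \<open>I\<close> to itself,
  by invariance of domain (\<open>homeomorphism_image_frontier\<close>). Doubling respects composition, and
  the double determines \<open>f\<close> because its restriction to \<open>A\<close> is conjugate to \<open>f\<close>.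

  What remains is that the piecewise linear self-homeomorphisms form a group and that doubles
  are piecewise linear. Both are awkward in terms of triangulations, since the natural pieces of a
  composite, of an inverse or of a glued map need not fit together along faces. They become
  easy once a map is known to be piecewise linear as soon as it is affine on each member of some
  finite family of polytopes covering its domain, overlapping in any way whatsoever; this is
  \<open>piecewise_linear_onI\<close>, which rests on \<open>triangulation_refining_polytopes\<close>.
\<close>

section \<open>Piecewise linear maps through polytope covers\<close>

lemma polyhedron_finite_halfspaces:
  fixes S :: "'a::euclidean_space set"
  assumes "polyhedron S"
  obtains H where "finite H" "S = {x. \<forall>(a,b)\<in>H. a \<bullet> x \<le> b}"
proof -
  obtain F where F: "finite F" "S = \<Inter>F" "\<forall>h\<in>F. \<exists>a b. a \<noteq> 0 \<and> h = {x. a \<bullet> x \<le> b}"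
    using assms unfolding polyhedron_def by blast
  then obtain a b where ab: "\<And>h. h \<in> F \<Longrightarrow> h = {x. a h \<bullet> x \<le> b h}"
    by metis
  have "x \<in> h \<longleftrightarrow> a h \<bullet> x \<le> b h" if "h \<in> F" for x h
    by (subst ab[OF that]) simp
  then have "S = {x. \<forall>(a,b)\<in>(\<lambda>h. (a h, b h)) ` F. a \<bullet> x \<le> b}"
    unfolding F(2) by auto
  then show thesis
    using that F(1) by blast
qed

text \<open>
  Cut a large box along all hyperplanes bounding the given polytopes. Each resulting cell lies on
  one side of every such hyperplane, so it meets each polytope in one of its own faces. Hence the
  faces of cells that lie in some polytope form a cell complex with the right union, and it can be
  triangulated.
\<close>

lemma triangulation_refining_polytopes:
  fixes \<Q> :: "'a::euclidean_space set set"
  assumes fin: "finite \<Q>" and poly: "\<And>Q. Q \<in> \<Q> \<Longrightarrow> polytope Q"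
  obtains \<T> where "simplicial_complex \<T>" "\<Union>\<T> = \<Union>\<Q>" "\<And>K. K \<in> \<T> \<Longrightarrow> \<exists>Q\<in>\<Q>. K \<subseteq> Q"
proof -
  have "\<forall>Q\<in>\<Q>. \<exists>H. finite H \<and> Q = {x. \<forall>(a,b)\<in>H. a \<bullet> x \<le> b}"
  proof
    fix Q assume "Q \<in> \<Q>"
    then obtain H where "finite H" "Q = {x. \<forall>(a,b)\<in>H. a \<bullet> x \<le> b}"
      by (rule polyhedron_finite_halfspaces[OF polytope_imp_polyhedron[OF poly]])
    then show "\<exists>H. finite H \<and> Q = {x. \<forall>(a,b)\<in>H. a \<bullet> x \<le> b}"
      by blast
  qed
  then have "\<exists>H. \<forall>Q\<in>\<Q>. finite (H Q) \<and> Q = {x. \<forall>(a,b)\<in>H Q. a \<bullet> x \<le> b}"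
    by (rule bchoice)
  then obtain H where HQ: "\<forall>Q\<in>\<Q>. finite (H Q) \<and> Q = {x. \<forall>(a,b)\<in>H Q. a \<bullet> x \<le> b}" ..
  note finH = HQ[THEN bspec, THEN conjunct1] and H = HQ[THEN bspec, THEN conjunct2]
  have "bounded (\<Union>\<Q>)"
    by (intro bounded_Union fin) (simp add: poly polytope_imp_bounded)
  then obtain c where c: "\<Union>\<Q> \<subseteq> cbox (-c) c"
    using bounded_subset_cbox_symmetric by blast
  have "finite (\<Union>(H ` \<Q>))"
    using fin finH by blast
  then obtain \<G> where \<G>: "\<Union>\<G> = cbox (-c) c" "finite \<G>" "\<forall>D\<in>\<G>. polytope D"
      "\<forall>X\<in>\<G>. \<forall>Y\<in>\<G>. X \<inter> Y face_of X"
    and side: "\<forall>D\<in>\<G>. \<forall>x\<in>D. \<forall>y\<in>D. \<forall>a b. (a,b) \<in> \<Union>(H ` \<Q>) \<longrightarrow>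
                 a \<bullet> x \<le> b \<and> a \<bullet> y \<le> b \<or> a \<bullet> x \<ge> b \<and> a \<bullet> y \<ge> b"
    using cell_subdivision_lemma[of "{cbox (-c) c}" "int DIM('a)" "\<Union>(H ` \<Q>)"]
    by (simp add: polytope_interval aff_dim_le_DIM face_of_refl) metis
  have face: "D \<inter> Q face_of D" if D: "D \<in> \<G>" and Q: "Q \<in> \<Q>" for D Q
  proof -
    have conv: "convex D"
      using D \<G>(3) polytope_imp_convex by blast
    have "D \<inter> {x. a \<bullet> x \<le> b} face_of D" if ab: "(a,b) \<in> H Q" for a b
    proof (cases "D \<subseteq> {x. a \<bullet> x \<le> b}")
      case True
      then have "D \<inter> {x. a \<bullet> x \<le> b} = D" by blast
      then show ?thesis
        using conv by (simp add: face_of_refl)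
    next
      case False
      then obtain x where x: "x \<in> D" "\<not> a \<bullet> x \<le> b" by blast
      have "(a,b) \<in> \<Union>(H ` \<Q>)"
        using Q ab by blast
      then have ge: "a \<bullet> y \<ge> b" if "y \<in> D" for y
        using side[rule_format, OF D x(1) that, of a b] x(2) by auto
      then have "D \<inter> {x. a \<bullet> x \<le> b} = D \<inter> {x. a \<bullet> x = b}"
        by force
      then show ?thesis
        using face_of_Int_supporting_hyperplane_ge[OF conv ge] by simp
    qed
    then have "T face_of D" if "T \<in> insert D ((\<lambda>(a,b). D \<inter> {x. a \<bullet> x \<le> b}) ` H Q)" for T
      using that face_of_refl[OF conv] by auto
    then have "\<Inter>(insert D ((\<lambda>(a,b). D \<inter> {x. a \<bullet> x \<le> b}) ` H Q)) face_of D"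
      by (intro face_of_Inter) simp
    moreover have "\<Inter>(insert D ((\<lambda>(a,b). D \<inter> {x. a \<bullet> x \<le> b}) ` H Q))
        = D \<inter> {x. \<forall>(a,b)\<in>H Q. a \<bullet> x \<le> b}"
      by auto
    ultimately have "D \<inter> {x. \<forall>(a,b)\<in>H Q. a \<bullet> x \<le> b} face_of D"
      by (rule subst[rotated])
    then show ?thesis
      by (rule subst[OF H[OF Q, symmetric], rotated])
  qed
  \<comment> \<open>Faces have to be included: a cell may meet the given polytopes in proper faces only.\<close>
  define \<M> where "\<M> = {F. (\<exists>D\<in>\<G>. F face_of D) \<and> (\<exists>Q\<in>\<Q>. F \<subseteq> Q)}"
  have "finite (\<Union>D\<in>\<G>. {F. F face_of D})"
    using \<G>(2,3) finite_polytope_faces by blast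
  then have "finite \<M>"
    by (rule rev_finite_subset) (auto simp: \<M>_def)
  moreover have "polytope C" if "C \<in> \<M>" for C
    using that \<G>(3) face_of_polytope_polytope unfolding \<M>_def by blast
  moreover have "C1 \<inter> C2 face_of C1" if C: "C1 \<in> \<M>" "C2 \<in> \<M>" for C1 C2
  proof -
    obtain D1 D2 where D: "D1 \<in> \<G>" "C1 face_of D1" "D2 \<in> \<G>" "C2 face_of D2"
      using C unfolding \<M>_def by blast
    have "D1 \<inter> D2 face_of D1" "D1 \<inter> D2 face_of D2"
      using \<G>(4) D(1,3) by (simp, metis Int_commute)
    then show ?thesis
      using face_of_Int_subface D(2,4) by blast
  qed
  ultimately obtain \<T> where \<T>: "simplicial_complex \<T>" "\<Union>\<T> = \<Union>\<M>"
      "\<And>K. K \<in> \<T> \<Longrightarrow> \<exists>C. C \<in> \<M> \<and> K \<subseteq> C"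
    using simplicial_subdivision_of_cell_complex[of \<M>] by metis
  have "\<Union>\<M> = \<Union>\<Q>"
  proof
    show "\<Union>\<M> \<subseteq> \<Union>\<Q>"
      by (auto simp: \<M>_def)
    show "\<Union>\<Q> \<subseteq> \<Union>\<M>"
    proof
      fix x assume "x \<in> \<Union>\<Q>"
      then obtain Q where Q: "x \<in> Q" "Q \<in> \<Q>" by blast
      then obtain D where D: "x \<in> D" "D \<in> \<G>"
        using c \<G>(1) by blast
      then have "D \<inter> Q \<in> \<M>"
        using face Q unfolding \<M>_def by blast
      then show "x \<in> \<Union>\<M>"
        using D Q by blast
    qed
  qed
  moreover have "\<exists>Q\<in>\<Q>. K \<subseteq> Q" if "K \<in> \<T>" for K
    using \<T>(3)[OF that] unfolding \<M>_def by blast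
  ultimately show thesis
    using that \<T>(1,2) by simp
qed

lemma affine_map_on_subset: "affine_map_on K f \<Longrightarrow> J \<subseteq> K \<Longrightarrow> affine_map_on J f"
  unfolding affine_map_on_def by blast

lemma piecewise_linear_onI:
  fixes f :: "'a::euclidean_space \<Rightarrow> 'b::euclidean_space"
  assumes "finite \<Q>" "\<And>Q. Q \<in> \<Q> \<Longrightarrow> polytope Q" "\<And>Q. Q \<in> \<Q> \<Longrightarrow> affine_map_on Q f"
    and P: "\<Union>\<Q> = P"
  shows "piecewise_linear_on P f"
proof -
  obtain \<T> where \<T>: "simplicial_complex \<T>" "\<Union>\<T> = \<Union>\<Q>" "\<And>K. K \<in> \<T> \<Longrightarrow> \<exists>Q\<in>\<Q>. K \<subseteq> Q"
    using triangulation_refining_polytopes assms(1,2) by blast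
  then show ?thesis
    unfolding piecewise_linear_on_def using affine_map_on_subset assms(3) P by metis
qed

lemma piecewise_linear_onE:
  fixes f :: "'a::euclidean_space \<Rightarrow> 'b::euclidean_space"
  assumes "piecewise_linear_on P f"
  obtains \<Q> where "finite \<Q>" "\<And>Q. Q \<in> \<Q> \<Longrightarrow> polytope Q" "\<And>Q. Q \<in> \<Q> \<Longrightarrow> affine_map_on Q f"
    "\<Union>\<Q> = P"
  using assms unfolding piecewise_linear_on_def simplicial_complex_def
  by (metis simplex_imp_polytope)

lemma piecewise_linear_on_cong:
  assumes "\<And>x. x \<in> P \<Longrightarrow> f x = g x"
  shows "piecewise_linear_on P f \<longleftrightarrow> piecewise_linear_on P g"
proof -
  have "affine_map_on K f \<longleftrightarrow> affine_map_on K g" if "K \<subseteq> P" for K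
    using that assms unfolding affine_map_on_def by (metis subsetD)
  then show ?thesis
    unfolding piecewise_linear_on_def by (metis Union_upper)
qed

lemma piecewise_linear_on_Un:
  fixes f :: "'a::euclidean_space \<Rightarrow> 'b::euclidean_space"
  assumes "piecewise_linear_on P f" "piecewise_linear_on Q f"
  shows "piecewise_linear_on (P \<union> Q) f"
proof -
  obtain \<P> where \<P>: "finite \<P>" "\<And>Q. Q \<in> \<P> \<Longrightarrow> polytope Q" "\<And>Q. Q \<in> \<P> \<Longrightarrow> affine_map_on Q f"
    "\<Union>\<P> = P"
    using piecewise_linear_onE[OF assms(1)] by metis
  obtain \<Q> where \<Q>: "finite \<Q>" "\<And>Q. Q \<in> \<Q> \<Longrightarrow> polytope Q" "\<And>Q. Q \<in> \<Q> \<Longrightarrow> affine_map_on Q f"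
    "\<Union>\<Q> = Q"
    using piecewise_linear_onE[OF assms(2)] by metis
  show ?thesis
    by (rule piecewise_linear_onI[of "\<P> \<union> \<Q>"]) (use \<P> \<Q> in auto)
qed

lemma affine_map_on_compose:
  assumes "affine_map_on K f" "affine_map_on J g" "f ` K \<subseteq> J"
  shows "affine_map_on K (g \<circ> f)"
proof -
  obtain L c where L: "linear L" "\<And>x. x \<in> K \<Longrightarrow> f x = L x + c"
    using assms(1) unfolding affine_map_on_def by blast
  obtain M d where M: "linear M" "\<And>x. x \<in> J \<Longrightarrow> g x = M x + d"
    using assms(2) unfolding affine_map_on_def by blast
  have "(g \<circ> f) x = (M \<circ> L) x + (M c + d)" if "x \<in> K" for x
    using that assms(3) L M by (simp add: image_subset_iff linear_add)
  then show ?thesis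
    unfolding affine_map_on_def using L(1) M(1) linear_compose by blast
qed

lemma polytope_affine_image:
  assumes "polytope K" "affine_map_on K f"
  shows "polytope (f ` K)"
proof -
  obtain L c where L: "linear L" "\<And>x. x \<in> K \<Longrightarrow> f x = L x + c"
    using assms(2) unfolding affine_map_on_def by blast
  have "f ` K = (+) c ` L ` K"
    using L(2) by (force simp: image_image add.commute)
  then show ?thesis
    using assms(1) L(1) by (simp add: polytope_translation_eq polytope_linear_image)
qed

lemma polytope_affine_preimage:
  fixes f :: "'a::euclidean_space \<Rightarrow> 'b::euclidean_space"
  assumes "polytope K" "affine_map_on K f" "polytope J"
  shows "polytope (K \<inter> f -` J)"
proof -
  obtain L c where L: "linear L" "\<And>x. x \<in> K \<Longrightarrow> f x = L x + c"
    using assms(2) unfolding affine_map_on_def by blast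
  obtain H where H: "finite H" "J = {y. \<forall>(a,b)\<in>H. a \<bullet> y \<le> b}"
    by (rule polyhedron_finite_halfspaces[OF polytope_imp_polyhedron[OF assms(3)]])
  define G where "G = (\<Inter>(a,b)\<in>H. {x. adjoint L a \<bullet> x \<le> b - a \<bullet> c})"
  have "polyhedron G"
    unfolding G_def using H(1)
    by (intro polyhedron_Inter) (auto intro: polyhedron_halfspace_le)
  moreover have "K \<inter> f -` J = K \<inter> G"
  proof -
    have "a \<bullet> f x \<le> b \<longleftrightarrow> adjoint L a \<bullet> x \<le> b - a \<bullet> c" if "x \<in> K" for x a b
    proof -
      have "adjoint L a \<bullet> x = a \<bullet> L x"
        by (rule adjoint_clauses(2)[OF L(1)])
      then show ?thesis
        using L(2)[OF that] by (simp add: inner_add_right le_diff_eq)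
    qed
    then show ?thesis
      unfolding G_def H(2) by auto
  qed
  ultimately show ?thesis
    using assms(1) by (simp add: polytope_Int_polyhedron)
qed

lemma piecewise_linear_on_compose:
  fixes f :: "'a::euclidean_space \<Rightarrow> 'b::euclidean_space"
    and g :: "'b \<Rightarrow> 'c::euclidean_space"
  assumes "piecewise_linear_on P f" "piecewise_linear_on Q g" "f ` P \<subseteq> Q"
  shows "piecewise_linear_on P (g \<circ> f)"
proof -
  obtain \<P> where \<P>: "finite \<P>" "\<And>K. K \<in> \<P> \<Longrightarrow> polytope K" "\<And>K. K \<in> \<P> \<Longrightarrow> affine_map_on K f"
    "\<Union>\<P> = P"
    using piecewise_linear_onE[OF assms(1)] by metis
  obtain \<Q> where \<Q>: "finite \<Q>" "\<And>K. K \<in> \<Q> \<Longrightarrow> polytope K" "\<And>K. K \<in> \<Q> \<Longrightarrow> affine_map_on K g"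
    "\<Union>\<Q> = Q"
    using piecewise_linear_onE[OF assms(2)] by metis
  define \<R> where "\<R> = (\<lambda>(K,J). K \<inter> f -` J) ` (\<P> \<times> \<Q>)"
  show ?thesis
  proof (rule piecewise_linear_onI)
    show "finite \<R>"
      using \<P>(1) \<Q>(1) by (simp add: \<R>_def)
    show "\<Union>\<R> = P"
      using \<P>(4) \<Q>(4) assms(3) unfolding \<R>_def by fastforce
    fix R assume "R \<in> \<R>"
    then obtain K J where KJ: "K \<in> \<P>" "J \<in> \<Q>" "R = K \<inter> f -` J"
      unfolding \<R>_def by blast
    then show "polytope R"
      using \<P> \<Q> polytope_affine_preimage by blast
    have "affine_map_on R f"
      using KJ \<P>(3) affine_map_on_subset by blast
    then show "affine_map_on R (g \<circ> f)"
      using KJ \<Q>(3) affine_map_on_compose by blast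
  qed
qed

text \<open>
  The affine extension \<open>L x + c\<close> of \<open>f\<close> need not be injective on the whole space, so \<open>L\<close> is inverted
  only on the direction space \<open>V\<close> of the affine hull of \<open>K\<close>. It is injective there, because a small
  multiple of any vector of \<open>V\<close> can be added to a relative interior point without leaving \<open>K\<close>,
  where \<open>f\<close> is injective.
\<close>

lemma affine_map_on_inverse:
  fixes f :: "'a::euclidean_space \<Rightarrow> 'b::euclidean_space"
  assumes "convex K" and aff: "affine_map_on K f" and gf: "\<And>x. x \<in> K \<Longrightarrow> g (f x) = x"
  shows "affine_map_on (f ` K) g"
proof (cases "K = {}")
  case True
  then show ?thesis
    unfolding affine_map_on_def using linear_zero by auto
next
  case False
  obtain L c where L: "linear L" "\<And>x. x \<in> K \<Longrightarrow> f x = L x + c"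
    using aff unfolding affine_map_on_def by blast
  obtain q where "q \<in> rel_interior K"
    using False assms(1) rel_interior_eq_empty by blast
  then obtain e where q: "q \<in> K" and e: "e > 0" "ball q e \<inter> affine hull K \<subseteq> K"
    by (auto simp: mem_rel_interior_ball)
  define V where "V = span ((\<lambda>x. -q + x) ` K)"
  have hull: "affine hull K = (\<lambda>x. q + x) ` V"
    unfolding V_def using affine_hull_span_gen hull_inc q by metis
  have "v = 0" if v: "v \<in> V" "L v = 0" for v
  proof (rule ccontr)
    assume nz: "v \<noteq> 0"
    define w where "w = (e / 2 / norm v) *\<^sub>R v"
    have "w \<in> V"
      unfolding w_def V_def using v(1) by (simp add: V_def span_scale)
    moreover have "norm w < e"
      using nz e(1) by (simp add: w_def)
    ultimately have "q + w \<in> K"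
      using e(2) hull by (auto simp: dist_norm)
    moreover have "L w = 0"
      unfolding w_def using v(2) L(1) by (simp add: linear_cmul)
    ultimately have "f (q + w) = f q"
      using L q by (simp add: linear_add)
    then have "q + w = q"
      using gf \<open>q + w \<in> K\<close> q by metis
    then show False
      using nz e(1) by (simp add: w_def)
  qed
  then have "inj_on L V"
    unfolding V_def using L(1) by (simp add: linear_injective_on_subspace_0)
  then obtain M where M: "linear M" "\<And>v. v \<in> V \<Longrightarrow> M (L v) = v"
    using linear_exists_left_inverse_on[OF L(1), of V] unfolding V_def by auto
  have "g (f x) = M (f x) + (q - M (f q))" if "x \<in> K" for x
  proof -
    have "x - q \<in> V"
      unfolding V_def using that by (intro span_base) auto
    then have "x - q = M (L x - L q)"
      using M(2)[of "x - q"] L(1) by (simp add: linear_diff)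
    also have "L x - L q = f x - f q"
      using L(2) that q by simp
    finally show ?thesis
      using M(1) gf[OF that] by (simp add: linear_diff algebra_simps)
  qed
  then show ?thesis
    unfolding affine_map_on_def using M(1) by blast
qed

lemma piecewise_linear_on_inverse:
  fixes f :: "'a::euclidean_space \<Rightarrow> 'b::euclidean_space"
  assumes "piecewise_linear_on P f" and gf: "\<And>x. x \<in> P \<Longrightarrow> g (f x) = x"
  shows "piecewise_linear_on (f ` P) g"
proof -
  obtain \<P> where \<P>: "finite \<P>" "\<And>K. K \<in> \<P> \<Longrightarrow> polytope K" "\<And>K. K \<in> \<P> \<Longrightarrow> affine_map_on K f"
    "\<Union>\<P> = P"
    using piecewise_linear_onE[OF assms(1)] by metis
  show ?thesis
  proof (rule piecewise_linear_onI)
    show "finite ((`) f ` \<P>)" "\<Union>((`) f ` \<P>) = f ` P"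
      using \<P> by auto
    show "polytope Q" if "Q \<in> (`) f ` \<P>" for Q
      using that \<P> polytope_affine_image by blast
    show "affine_map_on Q g" if "Q \<in> (`) f ` \<P>" for Q
      using that \<P> gf by (auto intro!: affine_map_on_inverse polytope_imp_convex)
  qed
qed

lemma piecewise_linear_on_affine:
  assumes "pl_polyhedron P" "affine_map_on P f"
  shows "piecewise_linear_on P f"
  using assms affine_map_on_subset unfolding pl_polyhedron_def piecewise_linear_on_def
  by (metis Union_upper)

section \<open>The groups of piecewise linear self-homeomorphisms\<close>

lemma carrier_PL_group:
  "f \<in> carrier (PL_group P) \<longleftrightarrow>
     f \<in> extensional P \<and> (\<exists>g. homeomorphism P P f g) \<and> piecewise_linear_on P f"
proof -
  have "bij_betw f P P" if "homeomorphism P P f g" for g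
    using that unfolding homeomorphism_def by (metis bij_betw_byWitness order_refl)
  then show ?thesis
    by (auto simp: PL_group_def Homeo_group_def pl_homeomorphism_def Bij_def)
qed

lemma carrier_PL_group_subset: "carrier (PL_group P) \<subseteq> carrier (BijGroup P)"
  by (auto simp: PL_group_def Homeo_group_def BijGroup_def)

lemma mult_PL_group:
  assumes "f \<in> carrier (PL_group P)" "g \<in> carrier (PL_group P)"
  shows "f \<otimes>\<^bsub>PL_group P\<^esub> g = compose P f g"
  using assms carrier_PL_group_subset[of P]
  by (auto simp: PL_group_def Homeo_group_def BijGroup_def)

lemma group_PL_group:
  assumes "pl_polyhedron P"
  shows "group (PL_group P)"
proof -
  interpret B: group "BijGroup P"
    by (rule group_BijGroup)
  have eq: "PL_group P = (BijGroup P)\<lparr>carrier := carrier (PL_group P)\<rparr>"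
    by (simp add: PL_group_def Homeo_group_def)
  have mult: "f \<otimes>\<^bsub>BijGroup P\<^esub> g = compose P f g"
    if "f \<in> carrier (PL_group P)" "g \<in> carrier (PL_group P)" for f g
    using that carrier_PL_group_subset[of P] by (auto simp: BijGroup_def)
  have closed: "compose P f g \<in> carrier (PL_group P)"
    if fg: "f \<in> carrier (PL_group P)" "g \<in> carrier (PL_group P)" for f g
  proof -
    obtain f' g' where f': "homeomorphism P P f f'" and g': "homeomorphism P P g g'"
      using fg unfolding carrier_PL_group by blast
    have "homeomorphism P P (f \<circ> g) (g' \<circ> f')"
      by (rule homeomorphism_compose[OF g' f'])
    then have "homeomorphism P P (compose P f g) (g' \<circ> f')"
      by (rule homeomorphism_cong) (auto simp: compose_def)
    moreover have "piecewise_linear_on P (f \<circ> g)"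
      using fg homeomorphism_image1[OF g'] unfolding carrier_PL_group
      by (intro piecewise_linear_on_compose[of P g P]) auto
    then have "piecewise_linear_on P (compose P f g)"
      by (rule piecewise_linear_on_cong[THEN iffD1, rotated]) (simp add: compose_def)
    ultimately show ?thesis
      unfolding carrier_PL_group by (auto simp: compose_extensional)
  qed
  have one: "restrict (\<lambda>x. x) P \<in> carrier (PL_group P)"
  proof -
    have "homeomorphism P P (restrict (\<lambda>x. x) P) (\<lambda>x. x)"
      by (rule homeomorphism_cong[OF homeomorphism_ident]) auto
    moreover have "affine_map_on P (restrict (\<lambda>x. x) P)"
      unfolding affine_map_on_def by (intro exI[of _ "\<lambda>x. x"] exI[of _ 0]) (auto simp: linear_ident)
    ultimately show ?thesis
      unfolding carrier_PL_group using assms piecewise_linear_on_affine by auto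
  qed
  have inverse: "inv\<^bsub>BijGroup P\<^esub> f \<in> carrier (PL_group P)" if f: "f \<in> carrier (PL_group P)" for f
  proof -
    obtain g where g: "homeomorphism P P f g"
      using f unfolding carrier_PL_group by blast
    define g' where "g' = restrict g P"
    have "homeomorphism P P g f"
      using g by (rule homeomorphism_symD)
    then have g'_hom: "homeomorphism P P g' f"
      by (rule homeomorphism_cong) (auto simp: g'_def)
    have "piecewise_linear_on (f ` P) g'"
      using f homeomorphism_apply2[OF g'_hom] unfolding carrier_PL_group
      by (intro piecewise_linear_on_inverse) auto
    then have g': "g' \<in> carrier (PL_group P)"
      using g'_hom homeomorphism_image1[OF g] unfolding carrier_PL_group by (auto simp: g'_def)
    have "compose P g' f = restrict (\<lambda>x. x) P"
      using homeomorphism_apply2[OF g'_hom] by (auto simp: compose_def)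
    then have "g' \<otimes>\<^bsub>BijGroup P\<^esub> f = \<one>\<^bsub>BijGroup P\<^esub>"
      using mult[OF g' f] by (simp add: BijGroup_def)
    then have "inv\<^bsub>BijGroup P\<^esub> f = g'"
      using f g' carrier_PL_group_subset by (intro B.inv_equality) auto
    then show ?thesis
      using g' by simp
  qed
  have "subgroup (carrier (PL_group P)) (BijGroup P)"
    using carrier_PL_group_subset one inverse closed mult
    by (intro B.subgroupI) auto
  then show ?thesis
    by (subst eq) (rule B.subgroup_imp_group)
qed

section \<open>Doubling a self-map across a mirror\<close>

text \<open>
  In the application \<open>r\<close> is the reflection across the plane of symmetry and \<open>A\<close> is one half of the
  sphere; the argument uses only the following properties of the pair.
\<close>

locale mirror_double =
  fixes r :: "'a::euclidean_space \<Rightarrow> 'a" and A :: "'a set"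
  assumes involution: "r (r x) = x"
    and seam_fixed: "x \<in> A \<Longrightarrow> x \<in> r ` A \<Longrightarrow> r x = x"
    and mirror_affine: "affine_map_on UNIV r"
    and closed_A: "closed A"
begin

definition preserves_seam :: "('a \<Rightarrow> 'a) \<Rightarrow> bool" where
  "preserves_seam g \<longleftrightarrow> g ` A \<subseteq> A \<and> g ` (A \<inter> r ` A) \<subseteq> A \<inter> r ` A"

definition double :: "('a \<Rightarrow> 'a) \<Rightarrow> 'a \<Rightarrow> 'a" where
  "double g = (\<lambda>x\<in>A \<union> r ` A. if x \<in> A then g x else r (g (r x)))"

lemma double_extensional: "double g \<in> extensional (A \<union> r ` A)"
  by (simp add: double_def)

lemma double_near: "x \<in> A \<Longrightarrow> double g x = g x"
  by (simp add: double_def)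

text \<open>
  This is where the seam matters: for a point of \<open>A\<close> whose mirror image also lies in \<open>A\<close>, the
  definition of the double chooses the value of \<open>g\<close> itself, and the two candidate values agree
  because \<open>r\<close> fixes the seam and \<open>g\<close> preserves it.
\<close>

lemma double_far:
  assumes g: "preserves_seam g" and x: "x \<in> A"
  shows "double g (r x) = r (g x)"
proof (cases "r x \<in> A")
  case True
  then have "r (r x) = r x"
    using x by (intro seam_fixed) auto
  then have fix_x: "r x = x"
    by (simp add: involution)
  then have "x \<in> A \<inter> r ` A"
    using x by (metis IntI imageI)
  then have "g x \<in> A \<inter> r ` A"
    using g unfolding preserves_seam_def by blast
  then have "r (g x) = g x"
    using seam_fixed by blast
  then show ?thesis
    using fix_x x by (simp add: double_near)
next
  case False
  then show ?thesis
    using x by (simp add: double_def involution)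
qed

lemma double_cong:
  assumes "\<And>x. x \<in> A \<Longrightarrow> f x = g x"
  shows "double f = double g"
  unfolding double_def using assms by (intro restrict_ext) (auto simp: involution)

lemma double_comp:
  assumes f: "preserves_seam f" and g: "preserves_seam g" and x: "x \<in> A \<union> r ` A"
  shows "double f (double g x) = double (f \<circ> g) x"
proof -
  have fg: "preserves_seam (f \<circ> g)"
    using f g unfolding preserves_seam_def by (auto simp: image_subset_iff)
  consider "x \<in> A" | y where "y \<in> A" "x = r y"
    using x by blast
  then show ?thesis
  proof cases
    case 1
    moreover have "g x \<in> A"
      using g 1 unfolding preserves_seam_def by blast
    ultimately show ?thesis
      by (simp add: double_near)
  next
    case 2
    moreover have "g y \<in> A"
      using g 2 unfolding preserves_seam_def by blast
    ultimately show ?thesis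
      by (simp add: double_far f g fg)
  qed
qed

lemma double_image_subset:
  assumes "preserves_seam g"
  shows "double g ` (A \<union> r ` A) \<subseteq> A \<union> r ` A"
proof -
  have "g x \<in> A" if "x \<in> A" for x
    using assms that unfolding preserves_seam_def by blast
  then show ?thesis
    by (auto simp: double_near double_far[OF assms])
qed

lemma double_far_eq:
  assumes "preserves_seam g" "y \<in> r ` A"
  shows "double g y = (r \<circ> g \<circ> r) y"
  using assms double_far by (auto simp: involution)

lemma continuous_mirror: "continuous_on T r"
proof -
  obtain L c where "linear L" "\<And>x. r x = L x + c"
    using mirror_affine unfolding affine_map_on_def by blast
  then have "r = (\<lambda>x. L x + c)" "continuous_on T L"
    by (auto simp: linear_continuous_on linear_conv_bounded_linear)
  then show ?thesis
    by (simp add: continuous_on_add)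
qed

lemma mirror_image_image: "r ` r ` A = A"
  by (simp add: image_image involution)

lemma closed_mirror_image: "closed (r ` A)"
proof -
  have "r ` A = r -` A"
    using involution by (auto simp: image_iff) metis
  then show ?thesis
    using continuous_closed_vimage[OF closed_A, of r] continuous_mirror[of UNIV]
    by (simp add: continuous_on_eq_continuous_at)
qed

lemma continuous_on_double:
  assumes "preserves_seam g" "continuous_on A g"
  shows "continuous_on (A \<union> r ` A) (double g)"
proof (rule continuous_on_closed_Un[OF closed_A closed_mirror_image])
  show "continuous_on A (double g)"
    using assms(2) by (rule continuous_on_eq) (simp add: double_near)
  have "continuous_on (r ` A) (r \<circ> g \<circ> r)"
    using assms(2) by (intro continuous_on_compose continuous_mirror) (simp add: mirror_image_image)
  then show "continuous_on (r ` A) (double g)"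
    by (rule continuous_on_eq) (simp add: double_far_eq assms(1))
qed

lemma homeomorphism_double:
  assumes hom: "homeomorphism A A f g" and f: "preserves_seam f" and g: "preserves_seam g"
  shows "homeomorphism (A \<union> r ` A) (A \<union> r ` A) (double f) (double g)"
proof (rule homeomorphismI)
  show "continuous_on (A \<union> r ` A) (double f)" "continuous_on (A \<union> r ` A) (double g)"
    using continuous_on_double[OF f homeomorphism_cont1[OF hom]]
      continuous_on_double[OF g homeomorphism_cont2[OF hom]] by simp_all
  show "double f ` (A \<union> r ` A) \<subseteq> A \<union> r ` A" "double g ` (A \<union> r ` A) \<subseteq> A \<union> r ` A"
    using f g by (auto intro!: double_image_subset simp del: image_subset_iff)
  have id: "double id x = x" if "x \<in> A \<union> r ` A" for x
    using that by (auto simp: double_def involution)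
  show "double g (double f x) = x" if "x \<in> A \<union> r ` A" for x
  proof -
    have "double (g \<circ> f) = double id"
      by (rule double_cong) (simp add: homeomorphism_apply1[OF hom])
    then show ?thesis
      using that by (simp add: double_comp f g id)
  qed
  show "double f (double g x) = x" if "x \<in> A \<union> r ` A" for x
  proof -
    have "double (f \<circ> g) = double id"
      by (rule double_cong) (simp add: homeomorphism_apply2[OF hom])
    then show ?thesis
      using that by (simp add: double_comp f g id)
  qed
qed

lemma piecewise_linear_on_double:
  assumes g: "preserves_seam g" and pl: "piecewise_linear_on A g"
  shows "piecewise_linear_on (A \<union> r ` A) (double g)"
proof (rule piecewise_linear_on_Un)
  show "piecewise_linear_on A (double g)"
    using pl by (rule piecewise_linear_on_cong[THEN iffD1, rotated]) (simp add: double_near)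
  have "pl_polyhedron A"
    using pl unfolding piecewise_linear_on_def pl_polyhedron_def by blast
  then have rA: "piecewise_linear_on A r"
    using mirror_affine affine_map_on_subset by (blast intro: piecewise_linear_on_affine)
  then have "piecewise_linear_on (r ` A) r"
    by (rule piecewise_linear_on_inverse) (rule involution)
  moreover have "piecewise_linear_on A (r \<circ> g)"
    using g by (intro piecewise_linear_on_compose[OF pl rA]) (simp add: preserves_seam_def)
  ultimately have "piecewise_linear_on (r ` A) (r \<circ> g \<circ> r)"
    by (rule piecewise_linear_on_compose) (simp add: mirror_image_image)
  then show "piecewise_linear_on (r ` A) (double g)"
    by (rule piecewise_linear_on_cong[THEN iffD1, rotated]) (simp add: double_far_eq g)
qed

end

section \<open>The embedding\<close>

text \<open>
  By invariance of domain the inverse maps the interior onto an open subset of \<open>S\<close>, hence into the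
  interior; so no frontier point can be mapped to an interior point.
\<close>

lemma homeomorphism_image_frontier:
  fixes S :: "'a::euclidean_space set"
  assumes "closed S" and hom: "homeomorphism S S f g"
  shows "f ` frontier S \<subseteq> frontier S"
proof clarify
  fix x assume x: "x \<in> frontier S"
  then have xS: "x \<in> S"
    using assms(1) frontier_subset_closed by blast
  have fx: "f x \<in> S"
    using xS homeomorphism_image1[OF hom] by blast
  have "f x \<notin> interior S"
  proof
    assume int: "f x \<in> interior S"
    have sub: "g ` interior S \<subseteq> S"
      using homeomorphism_image2[OF hom] interior_subset by blast
    have "inj_on g S"
      using homeomorphism_apply2[OF hom] by (rule inj_on_inverseI)
    then have "open (g ` interior S)"
      using homeomorphism_cont2[OF hom] interior_subset
      by (intro invariance_of_domain) (blast intro: continuous_on_subset inj_on_subset)+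
    moreover have "x \<in> g ` interior S"
      using int homeomorphism_apply1[OF hom xS] by force
    ultimately have "x \<in> interior S"
      using sub interiorI by blast
    then show False
      using x by (simp add: frontier_def)
  qed
  then show "f x \<in> frontier S"
    using fx assms(1) by (simp add: frontier_def)
qed

lemma reflect_across_involution:
  assumes "a \<noteq> 0"
  shows "reflect_across a b (reflect_across a b x) = x"
proof -
  let ?y = "reflect_across a b x"
  have flip: "a \<bullet> ?y - b = - (a \<bullet> x - b)"
    using assms by (simp add: reflect_across_def inner_diff_right)
  have "reflect_across a b ?y = ?y - (2 * (a \<bullet> ?y - b) / (a \<bullet> a)) *\<^sub>R a"
    by (rule reflect_across_def)
  also have "\<dots> = ?y + (2 * (a \<bullet> x - b) / (a \<bullet> a)) *\<^sub>R a"
    unfolding flip by (simp only: mult_minus_right minus_divide_left[symmetric]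
        scaleR_minus_left diff_minus_eq_add)
  also have "\<dots> = x"
    by (simp add: reflect_across_def)
  finally show ?thesis .
qed

lemma affine_map_on_reflect_across: "affine_map_on UNIV (reflect_across a b)"
proof -
  have "linear (\<lambda>x. x - (2 * (a \<bullet> x) / (a \<bullet> a)) *\<^sub>R a)"
    by (rule linearI) (simp_all add: inner_add_right algebra_simps add_divide_distrib)
  moreover have "reflect_across a b x = x - (2 * (a \<bullet> x) / (a \<bullet> a)) *\<^sub>R a + (2 * b / (a \<bullet> a)) *\<^sub>R a" for x
    by (simp add: reflect_across_def algebra_simps diff_divide_distrib)
  ultimately show ?thesis
    unfolding affine_map_on_def by blast
qed

theorem mainTheorem4:
  fixes I :: "(real ^ 'n) set" and S :: "(real ^ 'm) set"
  assumes "CARD('m) = CARD('n) + 1"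
    and "pl_polyhedron I" and "I homeomorphic cbox (0 :: real ^ 'n) 1"
    and "pl_polyhedron S" and "S homeomorphic sphere (0 :: real ^ 'm) 1"
    and "\<exists>a b. doubled_across a b I S"
  shows "\<exists>h. group_hom (PL_group I) (PL_group S) h \<and> inj_on h (carrier (PL_group I))"
proof -
  obtain a b where "doubled_across a b I S"
    using assms(6) by blast
  then obtain A \<phi> where a: "a \<noteq> 0" and pl\<phi>: "pl_homeomorphism I A \<phi>"
    and S: "S = A \<union> reflect_across a b ` A"
    and seam: "A \<inter> reflect_across a b ` A = \<phi> ` frontier I"
    and plane: "A \<inter> reflect_across a b ` A \<subseteq> {x. a \<bullet> x = b}"
    unfolding doubled_across_def by metis
  define r where "r = reflect_across a b"
  obtain \<phi>' where \<phi>: "homeomorphism I A \<phi> \<phi>'" and PL\<phi>: "piecewise_linear_on I \<phi>"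
    using pl\<phi> unfolding pl_homeomorphism_def by blast
  have PL\<phi>': "piecewise_linear_on A \<phi>'"
    using piecewise_linear_on_inverse[OF PL\<phi>, of \<phi>'] homeomorphism_apply1[OF \<phi>]
      homeomorphism_image1[OF \<phi>] by simp
  have compI: "compact I"
    using assms(3) compact_cbox homeomorphic_compactness by blast
  then have closedI: "closed I" by (rule compact_imp_closed)
  have compA: "compact A"
    using compI homeomorphism_cont1[OF \<phi>] homeomorphism_image1[OF \<phi>] compact_continuous_image by blast
  interpret mirror_double r A
  proof
    show "r (r x) = x" for x
      using a by (simp add: r_def reflect_across_involution)
    show "r x = x" if "x \<in> A" "x \<in> r ` A" for x
    proof -
      have "a \<bullet> x = b"
        using that plane unfolding r_def by blast
      then show ?thesis
        by (simp add: r_def reflect_across_def)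
    qed
    show "affine_map_on UNIV r"
      unfolding r_def by (rule affine_map_on_reflect_across)
    show "closed A"
      using compA by (rule compact_imp_closed)
  qed
  define conj where "conj f = \<phi> \<circ> f \<circ> \<phi>'" for f
  define h where "h f = double (conj f)" for f
  have conj_\<phi>: "conj f (\<phi> x) = \<phi> (f x)" if "x \<in> I" for f x
    using that by (simp add: conj_def homeomorphism_apply1[OF \<phi>])
  have A_image: "A = \<phi> ` I"
    using homeomorphism_image1[OF \<phi>] by simp
  have conj_hom: "homeomorphism A A (conj f) (conj g)" if "homeomorphism I I f g" for f g
    using homeomorphism_compose[OF homeomorphism_symD[OF \<phi>] homeomorphism_compose[OF that \<phi>]]
    by (simp add: conj_def comp_assoc)
  have conj_seam: "preserves_seam (conj f)" if f: "homeomorphism I I f g" for f g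
  proof -
    have "frontier I \<subseteq> I"
      using closedI by (rule frontier_subset_closed)
    then have "conj f ` \<phi> ` frontier I \<subseteq> \<phi> ` frontier I"
      using homeomorphism_image_frontier[OF closedI f] conj_\<phi> by (auto simp: image_subset_iff subset_iff)
    moreover have "conj f ` A = A"
      using conj_hom[OF f] by (rule homeomorphism_image1)
    ultimately show ?thesis
      unfolding preserves_seam_def seam[folded r_def] by simp
  qed
  have conj_pl: "piecewise_linear_on A (conj f)" if f: "f \<in> carrier (PL_group I)" for f
  proof -
    have "f ` I = I" "piecewise_linear_on I f"
      using f homeomorphism_image1 unfolding carrier_PL_group by blast+
    then have "piecewise_linear_on I (\<phi> \<circ> f)"
      by (intro piecewise_linear_on_compose[OF _ PL\<phi>]) auto
    then show ?thesis
      unfolding conj_def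
      using homeomorphism_image2[OF \<phi>] by (intro piecewise_linear_on_compose[OF PL\<phi>']) auto
  qed
  have S_eq: "S = A \<union> r ` A"
    using S by (simp add: r_def)
  have h_carrier: "h f \<in> carrier (PL_group S)" if f: "f \<in> carrier (PL_group I)" for f
  proof -
    obtain g where g: "homeomorphism I I f g"
      using f unfolding carrier_PL_group by blast
    have "homeomorphism S S (h f) (h g)"
      unfolding h_def S_eq
      by (rule homeomorphism_double[OF conj_hom[OF g] conj_seam[OF g]
            conj_seam[OF homeomorphism_symD[OF g]]])
    moreover have "piecewise_linear_on S (h f)"
      unfolding h_def S_eq by (rule piecewise_linear_on_double[OF conj_seam[OF g] conj_pl[OF f]])
    moreover have "h f \<in> extensional S"
      unfolding h_def S_eq by (rule double_extensional)
    ultimately show ?thesis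
      unfolding carrier_PL_group by blast
  qed
  have h_mult: "h (f \<otimes>\<^bsub>PL_group I\<^esub> g) = h f \<otimes>\<^bsub>PL_group S\<^esub> h g"
    if f: "f \<in> carrier (PL_group I)" and g: "g \<in> carrier (PL_group I)" for f g
  proof -
    obtain f' g' where f': "homeomorphism I I f f'" and g': "homeomorphism I I g g'"
      using f g unfolding carrier_PL_group by blast
    have "conj (compose I f g) (\<phi> x) = (conj f \<circ> conj g) (\<phi> x)" if "x \<in> I" for x
    proof -
      have "g x \<in> I"
        using that homeomorphism_image1[OF g'] by blast
      then show ?thesis
        using that by (simp add: conj_\<phi> compose_eq)
    qed
    then have "h (compose I f g) = double (conj f \<circ> conj g)"
      unfolding h_def by (intro double_cong) (auto simp: A_image)
    also have "\<dots> = compose S (h f) (h g)"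
    proof (rule extensionalityI)
      show "double (conj f \<circ> conj g) \<in> extensional S"
        unfolding S_eq by (rule double_extensional)
      show "double (conj f \<circ> conj g) x = compose S (h f) (h g) x" if "x \<in> S" for x
        using that double_comp[OF conj_seam[OF f'] conj_seam[OF g'], of x]
        by (simp add: compose_eq h_def S_eq)
    qed (rule compose_extensional)
    finally show ?thesis
      by (simp add: mult_PL_group f g h_carrier)
  qed
  have "inj_on h (carrier (PL_group I))"
  proof (rule inj_onI)
    fix f g assume f: "f \<in> carrier (PL_group I)" and g: "g \<in> carrier (PL_group I)" and eq: "h f = h g"
    show "f = g"
    proof (rule extensionalityI)
      show "f \<in> extensional I" "g \<in> extensional I"
        using f g unfolding carrier_PL_group by blast+
      fix x assume x: "x \<in> I"
      have "\<phi> x \<in> A"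
        using x A_image by blast
      then have "conj f (\<phi> x) = conj g (\<phi> x)"
        using fun_cong[OF eq, of "\<phi> x"] by (simp add: h_def double_near)
      then have "\<phi> (f x) = \<phi> (g x)"
        using x by (simp add: conj_\<phi>)
      moreover have "f x \<in> I" "g x \<in> I"
        using f g x homeomorphism_image1 unfolding carrier_PL_group by blast+
      ultimately show "f x = g x"
        using homeomorphism_apply1[OF \<phi>] by metis
    qed
  qed
  moreover have "group_hom (PL_group I) (PL_group S) h"
    using group_PL_group[OF assms(2)] group_PL_group[OF assms(4)] h_carrier h_mult
    by (intro group_hom.intro group_hom_axioms.intro homI) auto
  ultimately show ?thesis
    by blast
qed

end
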